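(* Let $m_1,m_2,m_3,m_4\in\mathbb{R}$. Put $v_1(x)=1+\sum_{k=1}^4\frac{m_k}{k!}x^k$, $u_1(x)=\log v_1(x)$ (for $x$ near $0$), $\kappa_n=u_1^{(n)}(0)$ for $1\le n\le 4$, and $$q(x)=\det\left(\begin{pmatrix}\kappa_1&\kappa_2\\ \kappa_2&\kappa_3\end{pmatrix}x-\begin{pmatrix}\kappa_2&\kappa_3\\ \kappa_3&\kappa_4\end{pmatrix}\right).$$ Assume $q$ has degree $2$ and its roots $r_1,r_2$ are real, nonzero and satisfy $r_1<r_2$. Let $$V=\begin{pmatrix}1&r_1\\ 1&r_2\end{pmatrix},\qquad D=\begin{pmatrix}r_1&0\\ 0&r_2\end{pmatrix},\qquad \lambda=\begin{pmatrix}\lambda_1\\ \lambda_2\end{pmatrix}=D^{-1}(V^T)^{-1}\begin{pmatrix}\kappa_1\\ \kappa_2\end{pmatrix},$$ and assume $\lambda_1,\lambda_2>0$. For real $C>1$ set $N_d(0)=\lfloor\lambda_1C\rfloor$, $N_u(0)=\lfloor\lambda_2C\rfloor$, $d=\exp r_1$, $u=\exp r_2$, and for $1\le n\le 4$ $$\mu(C,n)=\sum_{\substack{n_u,n_d\in\mathbb{N}_0\\ n_u+n_d=n}}\frac{n!}{n_u!\,n_d!}r_1^{n_d}r_2^{n_u}\sum_{k_u=0}^{n_u}\frac{N_u(0)!}{(N_u(0)-k_u)!}\left\{\begin{matrix}n_u\\ k_u\end{matrix}\right\}\sum_{k_d=0}^{n_d}\frac{N_d(0)!}{(N_d(0)-k_d)!}\left\{\begin{matrix}n_d\\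 k_d\end{matrix}\right\}C^{-(k_u+k_d)}.$$ For an integer $N\ge \max(1,N_u(0)+N_d(0))$ set $t=\lfloor -N\log(1-C^{-1})\rfloor$, and let $M(C,N,n)=\mathbb{E}\left(\left(\log\frac{p(t)}{p(0)}\right)^n\right)$ in the bulls-and-bears model with parameters $N,N_u(0),N_d(0),u,d$. Then for every $\varepsilon>0$: (i) there is $C_0>1$ such that for all real $C\ge C_0$ and all $1\le n\le 4$, $|\mu(C,n)-m_n|<\varepsilon$; (ii) for every real $C>1$ such that $|\mu(C,n)-m_n|<\varepsilon$ for all $1\le n\le 4$, there is $N_0$ such that for all integers $N\ge N_0$ and all $1\le n\le 4$, $|M(C,N,n)-m_n|<\varepsilon$. In particular, choosing first $C$ and then $N$ sufficiently large, the first four moments of $\log(p(t)/p(0))$ approximate $m_1,\dots,m_4$ with error less than $\varepsilon$.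
   Context: $\mathbb{N}_0$ denotes the nonnegative integers. The bulls-and-bears model with parameters $N,N_u(0),N_d(0),u,d$ (integers $N\ge1$, $N_u(0),N_d(0)\ge 0$, $N_u(0)+N_d(0)\le N$; here $u,d$ are positive reals): there are $N$ investors. The process $(N_u(t),N_d(t),p(t))_{t\in\mathbb{N}_0}$ starts from the deterministic values $N_u(0),N_d(0),p(0)>0$. At each time $t$, conditionally on the whole history up to time $t$, exactly one of the following occurs: (bull chosen) with probability $N_u(t)/N$, $p(t+1)=u\,p(t)$, $N_u(t+1)=N_u(t)-1$, $N_d(t+1)=N_d(t)$; (bear chosen) with probability $N_d(t)/N$, $p(t+1)=d\,p(t)$, $N_d(t+1)=N_d(t)-1$, $N_u(t+1)=N_u(t)$; (inactive investor chosen) with probability $(N-N_u(t)-N_d(t))/N$, $p(t+1)=p(t)$, $N_u(t+1)=N_u(t)$, $N_d(t+1)=N_d(t)$. $\left\{\begin{matrix}n\\ k\end{matrix}\right\}$ is the Stirling number of the second kind: the number of partitions of a set of $n$ elements into $k$ nonempty sets (so $\left\{\begin{matrix}0\\ 0\end{matrix}\right\}=1$). For integers $a,l\ge 0$, $\frac{a!}{(a-l)!}$ denotes the falling factorial $a(a-1)\cdots(a-l+1)$, which is $0$ if $l>a$. Convention: $0^0=1$. *)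

theory Defs
  imports
    "HOL-Probability.Probability"
    "HOL-Computational_Algebra.Polynomial"
    "HOL-Combinatorics.Stirling"
begin

text \<open>A state is the triple \<open>(N_u(t), N_d(t), p(t))\<close>. In each step one of the \<open>N\<close> investors is
  chosen uniformly; the investors \<open>i < N_u(t)\<close> are the bulls, the next \<open>N_d(t)\<close> ones the bears,
  and all others are inactive.\<close>

type_synonym bb_state = "nat \<times> nat \<times> real"

definition bb_step :: "nat \<Rightarrow> real \<Rightarrow> real \<Rightarrow> bb_state \<Rightarrow> bb_state pmf" where
  "bb_step N u d = (\<lambda>(nu, nd, p).
     map_pmf (\<lambda>i. if i < nu then (nu - 1, nd, u * p)
                  else if i < nu + nd then (nu, nd - 1, d * p)
                  else (nu, nd, p))
       (pmf_of_set {..<N}))"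

text \<open>\<open>bb_path N nu0 nd0 u d p0 t\<close> is the joint law of the states at the times \<open>0, \<dots>, t\<close>,
  listed in chronological order.\<close>

primrec bb_path ::
  "nat \<Rightarrow> nat \<Rightarrow> nat \<Rightarrow> real \<Rightarrow> real \<Rightarrow> real \<Rightarrow> nat \<Rightarrow> bb_state list pmf" where
  "bb_path N nu0 nd0 u d p0 0 = return_pmf [(nu0, nd0, p0)]"
| "bb_path N nu0 nd0 u d p0 (Suc t) =
     bind_pmf (bb_path N nu0 nd0 u d p0 t)
       (\<lambda>h. map_pmf (\<lambda>s. h @ [s]) (bb_step N u d (last h)))"

definition price :: "bb_state \<Rightarrow> real" where
  "price s = snd (snd s)"

definition log_return_moment ::
  "nat \<Rightarrow> nat \<Rightarrow> nat \<Rightarrow> real \<Rightarrow> real \<Rightarrow> real \<Rightarrow> nat \<Rightarrow> nat \<Rightarrow> real" where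
  "log_return_moment N nu0 nd0 u d p0 t n =
     measure_pmf.expectation (bb_path N nu0 nd0 u d p0 t) (\<lambda>h. (ln (price (h ! t) / p0)) ^ n)"

lemma bb_step_probabilities:
  assumes "N \<ge> 1" "nu + nd \<le> N"
  shows "nu > 0 \<Longrightarrow> pmf (bb_step N u d (nu, nd, p)) (nu - 1, nd, u * p) = real nu / real N"
    and "nd > 0 \<Longrightarrow> pmf (bb_step N u d (nu, nd, p)) (nu, nd - 1, d * p) = real nd / real N"
    and "pmf (bb_step N u d (nu, nd, p)) (nu, nd, p) = real (N - nu - nd) / real N"
proof -
  have *: "pmf (bb_step N u d (nu, nd, p)) s = real (card A) / real N"
    if "{..<N} \<inter> {i. (if i < nu then (nu - 1, nd, u * p)
          else if i < nu + nd then (nu, nd - 1, d * p) else (nu, nd, p)) = s} = A" for s A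
  proof -
    have "{..<N} \<noteq> {}"
      using assms by (auto simp: lessThan_empty_iff)
    then show ?thesis
      using that by (simp add: bb_step_def pmf_map measure_pmf_of_set vimage_def)
  qed
  show "pmf (bb_step N u d (nu, nd, p)) (nu - 1, nd, u * p) = real nu / real N" if "nu > 0"
    using *[of "(nu - 1, nd, u * p)" "{..<nu}"] that assms by (force split: if_splits)
  show "pmf (bb_step N u d (nu, nd, p)) (nu, nd - 1, d * p) = real nd / real N" if "nd > 0"
    using *[of "(nu, nd - 1, d * p)" "{nu..<nu + nd}"] that assms by (force split: if_splits)
  show "pmf (bb_step N u d (nu, nd, p)) (nu, nd, p) = real (N - nu - nd) / real N"
  proof -
    have "pmf (bb_step N u d (nu, nd, p)) (nu, nd, p) = real (card {nu + nd..<N}) / real N"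
      by (rule *) (use assms in \<open>auto split: if_splits\<close>)
    then show ?thesis by simp
  qed
qed

lemma bb_path_Suc_history:
  "pmf (bb_path N nu0 nd0 u d p0 (Suc t)) (h @ [s]) =
     pmf (bb_path N nu0 nd0 u d p0 t) h * pmf (bb_step N u d (last h)) s"
proof -
  have inj: "inj (\<lambda>s. h @ [s])" for h :: "bb_state list" by (auto intro: injI)
  have "pmf (map_pmf (\<lambda>s. h' @ [s]) (bb_step N u d (last h'))) (h @ [s]) =
      pmf (bb_step N u d (last h)) s * indicator {h} h'" for h'
  proof (cases "h' = h")
    case True
    then show ?thesis using pmf_map_inj'[OF inj[of h]] by simp
  next
    case False
    then show ?thesis by (auto simp: pmf_eq_0_set_pmf)
  qed
  then show ?thesis
    by (simp add: pmf_bind measure_pmf_single)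
qed

definition falling_fact :: "nat \<Rightarrow> nat \<Rightarrow> real" where
  "falling_fact a l = (\<Prod>i<l. real a - real i)"

definition approx_moment :: "real \<Rightarrow> real \<Rightarrow> nat \<Rightarrow> nat \<Rightarrow> real \<Rightarrow> nat \<Rightarrow> real" where
  "approx_moment r1 r2 Nu0 Nd0 C n =
     (\<Sum>(nu, nd) \<in> {(nu, nd). nu + nd = n}.
        fact n / (fact nu * fact nd) * r1 ^ nd * r2 ^ nu *
        (\<Sum>ku\<le>nu. falling_fact Nu0 ku * real (Stirling nu ku) *
          (\<Sum>kd\<le>nd. falling_fact Nd0 kd * real (Stirling nd kd) * C powi (- int (ku + kd)))))"

definition moment_poly :: "(nat \<Rightarrow> real) \<Rightarrow> real \<Rightarrow> real" where
  "moment_poly m x = 1 + (\<Sum>k=1..4. m k / fact k * x ^ k)"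

text \<open>Only the germ of the logarithm at \<open>0\<close> matters, and \<open>moment_poly m 0 = 1\<close>.\<close>

definition cumulant :: "(nat \<Rightarrow> real) \<Rightarrow> nat \<Rightarrow> real" where
  "cumulant m n = (deriv ^^ n) (\<lambda>x. ln (moment_poly m x)) 0"

definition hankel0 :: "(nat \<Rightarrow> real) \<Rightarrow> real^2^2" where
  "hankel0 m = vector [vector [cumulant m 1, cumulant m 2], vector [cumulant m 2, cumulant m 3]]"

definition hankel1 :: "(nat \<Rightarrow> real) \<Rightarrow> real^2^2" where
  "hankel1 m = vector [vector [cumulant m 2, cumulant m 3], vector [cumulant m 3, cumulant m 4]]"

definition pencil_poly :: "(nat \<Rightarrow> real) \<Rightarrow> real poly" where
  "pencil_poly m =
     det (\<chi> i j. smult (hankel0 m $ i $ j) [:0, 1:] - [:hankel1 m $ i $ j:] :: real poly^2^2)"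

definition vmat :: "real \<Rightarrow> real \<Rightarrow> real^2^2" where
  "vmat r1 r2 = vector [vector [1, r1], vector [1, r2]]"

definition dmat :: "real \<Rightarrow> real \<Rightarrow> real^2^2" where
  "dmat r1 r2 = vector [vector [r1, 0], vector [0, r2]]"

definition lam :: "(nat \<Rightarrow> real) \<Rightarrow> real \<Rightarrow> real \<Rightarrow> real^2" where
  "lam m r1 r2 = matrix_inv (dmat r1 r2) *v
     (matrix_inv (transpose (vmat r1 r2)) *v vector [cumulant m 1, cumulant m 2])"

definition num_bears :: "(nat \<Rightarrow> real) \<Rightarrow> real \<Rightarrow> real \<Rightarrow> real \<Rightarrow> nat" where
  "num_bears m r1 r2 C = nat \<lfloor>lam m r1 r2 $ 1 * C\<rfloor>"

definition num_bulls :: "(nat \<Rightarrow> real) \<Rightarrow> real \<Rightarrow> real \<Rightarrow> real \<Rightarrow> nat" where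
  "num_bulls m r1 r2 C = nat \<lfloor>lam m r1 r2 $ 2 * C\<rfloor>"

definition mu :: "(nat \<Rightarrow> real) \<Rightarrow> real \<Rightarrow> real \<Rightarrow> real \<Rightarrow> nat \<Rightarrow> real" where
  "mu m r1 r2 C n = approx_moment r1 r2 (num_bulls m r1 r2 C) (num_bears m r1 r2 C) C n"

definition model_time :: "real \<Rightarrow> nat \<Rightarrow> nat" where
  "model_time C N = nat \<lfloor>- real N * ln (1 - 1 / C)\<rfloor>"

definition model_moment ::
  "(nat \<Rightarrow> real) \<Rightarrow> real \<Rightarrow> real \<Rightarrow> real \<Rightarrow> real \<Rightarrow> nat \<Rightarrow> nat \<Rightarrow> real" where
  "model_moment m r1 r2 p0 C N n =
     log_return_moment N (num_bulls m r1 r2 C) (num_bears m r1 r2 C) (exp r2) (exp r1) p0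
       (model_time C N) n"

end

theory Submission
  imports Defs "HOL-Real_Asymp.Real_Asymp"
begin

text \<open>The logarithmic return is \<open>r2 X + r1 Y\<close>, where \<open>X\<close> and \<open>Y\<close> count the bulls and bears chosen so
  far. Products of falling factorials of the remaining bull and bear counts are eigenfunctions of a
  step of the chain with eigenvalue \<open>1 - (a + b) / N\<close>, so their expectations are explicit; at the
  time \<open>t \<approx> - N ln (1 - 1 / C)\<close> the eigenvalue power tends to \<open>(1 - 1 / C)\<close> to the power \<open>a + b\<close>. By
  the Vandermonde identity, \<open>X\<close> and \<open>Y\<close> then have in the limit the joint factorial moments of
  independent binomial variables with success probability \<open>1 / C\<close>, and Stirling numbers turn these
  into \<open>\<mu>(C, n)\<close>. For \<open>C \<rightarrow> \<infinity>\<close> the binomials become Poisson variables with means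
  \<open>\<lambda>\<^sub>2\<close> and \<open>\<lambda>\<^sub>1\<close>, so \<open>r2 X + r1 Y\<close> has the cumulants \<open>\<lambda>\<^sub>1 r1\<^sup>n + \<lambda>\<^sub>2 r2\<^sup>n\<close>. That these
  equal \<open>\<kappa>\<^sub>n\<close> is Prony's method: for \<open>n = 1, 2\<close> it is the definition of \<open>\<lambda>\<close>, and the pencil polynomial
  provides the linear recurrence for \<open>n = 3, 4\<close>.\<close>

section \<open>Falling factorials\<close>

text \<open>The base is real, unlike in \<open>falling_fact\<close>, because
  \<open>ffact_diff\<close> shifts it to \<open>a - real j\<close>, which may be negative.\<close>

definition ffact :: "real \<Rightarrow> nat \<Rightarrow> real" where
  "ffact x k = (\<Prod>i<k. x - real i)"

lemma falling_fact_eq: "falling_fact a k = ffact (real a) k"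
  by (simp add: falling_fact_def ffact_def)

lemma ffact_0 [simp]: "ffact x 0 = 1"
  by (simp add: ffact_def)

lemma ffact_Suc: "ffact x (Suc k) = ffact x k * (x - real k)"
  by (simp add: ffact_def)

lemma ffact_Suc_shift: "ffact x (Suc k) = x * ffact (x - 1) k"
  by (simp add: ffact_def prod.lessThan_Suc_shift algebra_simps del: prod.lessThan_Suc)

text \<open>Both sides are \<open>ffact x (Suc a)\<close>, with its last or its first factor split
  off.\<close>

lemma ffact_eq_shift: "(x - real a) * ffact x a = x * ffact (x - 1) a"
  using ffact_Suc[of x a] ffact_Suc_shift[of x a] by (simp add: mult.commute)

text \<open>Induction on \<open>n\<close>:
  \<open>x * ffact x k = ffact x (Suc k) + real k * ffact x k\<close> mirrors the recurrence of the
  Stirling numbers.\<close>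

lemma power_eq_sum_Stirling_ffact: "x ^ n = (\<Sum>k\<le>n. real (Stirling n k) * ffact x k)"
proof (induction n)
  case (Suc n)
  have "(\<Sum>k\<le>Suc n. real (Stirling (Suc n) k) * ffact x k)
      = (\<Sum>k\<le>n. real (Stirling (Suc n) (Suc k)) * ffact x (Suc k))"
    by (simp add: sum.atMost_Suc_shift del: sum.atMost_Suc)
  also have "\<dots> = (\<Sum>k\<le>n. real (Suc k) * real (Stirling n (Suc k)) * ffact x (Suc k))
      + (\<Sum>k\<le>n. real (Stirling n k) * ffact x (Suc k))"
    by (simp add: sum.distrib algebra_simps)
  \<comment> \<open>The index shift adds only a term with factor \<open>0\<close>; the top term then
    drops out since \<open>Stirling n (Suc n) = 0\<close>.\<close>
  also have "(\<Sum>k\<le>n. real (Suc k) * real (Stirling n (Suc k)) * ffact x (Suc k))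
      = (\<Sum>k\<le>Suc n. real k * real (Stirling n k) * ffact x k)"
    by (simp add: sum.atMost_Suc_shift del: sum.atMost_Suc)
  also have "\<dots> = (\<Sum>k\<le>n. real k * real (Stirling n k) * ffact x k)"
    by simp
  also have "\<dots> + (\<Sum>k\<le>n. real (Stirling n k) * ffact x (Suc k))
      = x * (\<Sum>k\<le>n. real (Stirling n k) * ffact x k)"
    by (simp add: ffact_Suc sum_distrib_left algebra_simps flip: sum.distrib)
  finally show ?case using Suc by simp
qed simp

text \<open>The expansion is in falling factorials of \<open>x\<close> because for the remaining
  counts their expectations are explicit. For naturals \<open>x \<le> a\<close> it is
  inclusion-exclusion for injections of \<open>k\<close> points into \<open>a\<close> values that
  avoid \<open>x\<close> of them.\<close>

lemma ffact_diff:
  "ffact (a - x) k =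
     (\<Sum>j\<le>k. real (k choose j) * (- 1) ^ j * ffact x j * ffact (a - real j) (k - j))"
proof (induction k arbitrary: a)
  case (Suc k)
  define g where "g j = (- 1) ^ j * ffact x j * ffact (a - real j) (Suc k - j)" for j
  \<comment> \<open>Write \<open>a - x\<close> as \<open>(a - real j) - (x - real j)\<close>: the
    first part lengthens the factorial in \<open>a\<close>, the second the one in \<open>x\<close>.
    Pascal's rule then merges the two sums.\<close>
  have split: "(a - x) * ((- 1) ^ j * ffact x j * ffact (a - 1 - real j) (k - j)) = g j + g (Suc j)"
    if "j \<le> k" for j
  proof -
    have 1: "ffact (a - real j) (Suc k - j) = (a - real j) * ffact (a - 1 - real j) (k - j)"
      using that ffact_Suc_shift[of "a - real j" "k - j"] by (simp add: Suc_diff_le algebra_simps)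
    have 2: "ffact (a - real (Suc j)) (Suc k - Suc j) = ffact (a - 1 - real j) (k - j)"
      by (simp add: algebra_simps)
    show ?thesis unfolding g_def 1 2 by (simp add: ffact_Suc algebra_simps)
  qed
  have "ffact (a - x) (Suc k) = (a - x) * ffact (a - 1 - x) k"
    by (simp add: ffact_Suc_shift algebra_simps)
  also have "\<dots> = (\<Sum>j\<le>k. real (k choose j) *
      ((a - x) * ((- 1) ^ j * ffact x j * ffact (a - 1 - real j) (k - j))))"
    by (simp add: Suc.IH sum_distrib_left mult_ac)
  also have "\<dots> = (\<Sum>j\<le>k. real (k choose j) * g j) + (\<Sum>j\<le>k. real (k choose j) * g (Suc j))"
    by (simp add: split sum.distrib distrib_left)
  also have "(\<Sum>j\<le>k. real (k choose j) * g j) = (\<Sum>j\<le>Suc k. real (k choose j) * g j)"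
    by simp
  also have "\<dots> = g 0 + (\<Sum>j\<le>k. real (k choose Suc j) * g (Suc j))"
    by (simp add: sum.atMost_Suc_shift del: sum.atMost_Suc)
  also have "\<dots> + (\<Sum>j\<le>k. real (k choose j) * g (Suc j))
      = (\<Sum>j\<le>Suc k. real (Suc k choose j) * g j)"
    by (simp add: sum.atMost_Suc_shift sum.distrib algebra_simps del: sum.atMost_Suc)
  finally show ?case by (simp add: g_def mult.assoc)
qed simp

lemma ffact_mult_shift:
  assumes "j \<le> k"
  shows "ffact a j * ffact (a - real j) (k - j) = ffact a k"
proof -
  have "ffact a j * ffact (a - real j) i = ffact a (j + i)" for i
    by (induction i) (simp_all add: ffact_Suc algebra_simps)
  from this[of "k - j"] show ?thesis using assms by simp
qed

text \<open>This is the right side of \<open>ffact_diff\<close> with \<open>ffact x j\<close>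
  replaced by \<open>ffact a j * q ^ j\<close>, for natural \<open>a\<close> the factorial moment of
  a binomial variable. By \<open>ffact_mult_shift\<close> and the binomial theorem, the factorial
  moment of the number of failures remains.\<close>

lemma sum_binomial_ffact:
  "(\<Sum>j\<le>k. real (k choose j) * (- 1) ^ j * (ffact a j * q ^ j) * ffact (a - real j) (k - j))
     = ffact a k * (1 - q) ^ k"
proof -
  have "(\<Sum>j\<le>k. real (k choose j) * (- 1) ^ j * (ffact a j * q ^ j) * ffact (a - real j) (k - j))
      = (\<Sum>j\<le>k. ffact a k * (real (k choose j) * (- q) ^ j * 1 ^ (k - j)))"
  proof (rule sum.cong[OF refl])
    fix j assume "j \<in> {..k}"
    then have "ffact a k = ffact a j * ffact (a - real j) (k - j)"
      by (simp add: ffact_mult_shift)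
    then show "real (k choose j) * (- 1) ^ j * (ffact a j * q ^ j) * ffact (a - real j) (k - j)
        = ffact a k * (real (k choose j) * (- q) ^ j * 1 ^ (k - j))"
      by (simp add: power_minus[of q] mult_ac)
  qed
  also have "\<dots> = ffact a k * (- q + 1) ^ k"
    unfolding binomial_ring sum_distrib_left ..
  finally show ?thesis by simp
qed

section \<open>Moments of the model\<close>

text \<open>The investors form three blocks with constant outcome. If \<open>nu\<close> or
  \<open>nd\<close> is \<open>0\<close>, the term with the truncated \<open>nu - 1\<close> or
  \<open>nd - 1\<close> has weight \<open>0\<close>.\<close>

lemma expectation_bb_step:
  fixes g :: "bb_state \<Rightarrow> real"
  assumes "N \<ge> 1" "nu + nd \<le> N"
  shows "measure_pmf.expectation (bb_step N u d (nu, nd, p)) g =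
    (real nu * g (nu - 1, nd, u * p) + real nd * g (nu, nd - 1, d * p)
      + (real N - real nu - real nd) * g (nu, nd, p)) / real N"
proof -
  define h where "h i = g (if i < nu then (nu - 1, nd, u * p)
                  else if i < nu + nd then (nu, nd - 1, d * p)
                  else (nu, nd, p))" for i
  have ne: "{..<N} \<noteq> {}"
    using assms by (auto simp: lessThan_empty_iff)
  have "measure_pmf.expectation (bb_step N u d (nu, nd, p)) g = sum h {..<N} / real N"
    using ne by (simp add: bb_step_def integral_pmf_of_set h_def)
  also have "{..<N} = {..<nu} \<union> {nu..<nu+nd} \<union> {nu+nd..<N}"
    using assms by auto
  also have "sum h \<dots> = sum h {..<nu} + sum h {nu..<nu+nd} + sum h {nu+nd..<N}"
    by (subst sum.union_disjoint; (subst sum.union_disjoint)?) auto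
  also have "sum h {..<nu} = real nu * g (nu - 1, nd, u * p)"
    by (simp add: h_def)
  also have "sum h {nu..<nu+nd} = real nd * g (nu, nd - 1, d * p)"
    by (simp add: h_def)
  also have "sum h {nu+nd..<N} = (real N - real nu - real nd) * g (nu, nd, p)"
    using assms by (simp add: h_def of_nat_diff)
  finally show ?thesis .
qed

section \<open>Support of the path law\<close>

lemma finite_set_bb_step: "N \<ge> 1 \<Longrightarrow> finite (set_pmf (bb_step N u d s))"
  by (cases s) (auto simp: bb_step_def lessThan_empty_iff)

lemma finite_set_bb_path:
  assumes "N \<ge> 1"
  shows "finite (set_pmf (bb_path N nu0 nd0 u d p0 t))"
  by (induction t) (auto simp: finite_set_bb_step[OF assms])

lemma set_bb_step:
  assumes "N \<ge> 1"
  shows "set_pmf (bb_step N u d (nu, nd, p)) \<subseteq>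
    {s. s = (nu, nd, p) \<or> nu > 0 \<and> s = (nu - 1, nd, u * p) \<or> nd > 0 \<and> s = (nu, nd - 1, d * p)}"
  using assms by (auto simp: bb_step_def lessThan_empty_iff split: if_splits)

lemma length_bb_path: "h \<in> set_pmf (bb_path N nu0 nd0 u d p0 t) \<Longrightarrow> length h = Suc t"
  by (induction t arbitrary: h) auto

lemma last_bb_path:
  assumes "h \<in> set_pmf (bb_path N nu0 nd0 u d p0 t)"
  shows "last h = h ! t"
proof -
  have "length h = Suc t" using length_bb_path[OF assms] .
  then show ?thesis by (subst last_conv_nth) auto
qed

text \<open>Each chosen bull multiplies the price by \<open>exp r2\<close> and each chosen bear by
  \<open>exp r1\<close>, so the remaining counts determine the price. With
  \<open>nu0 + nd0 \<le> N\<close>, the bounds later give \<open>nu + nd \<le> N\<close>.\<close>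

lemma bb_path_invariant:
  assumes "N \<ge> 1" "h \<in> set_pmf (bb_path N nu0 nd0 (exp r2) (exp r1) p0 t)"
  shows "\<exists>nu nd. nu \<le> nu0 \<and> nd \<le> nd0 \<and>
    h ! t = (nu, nd, p0 * exp (r2 * (real nu0 - real nu) + r1 * (real nd0 - real nd)))"
  using assms(2)
proof (induction t arbitrary: h)
  case 0
  then show ?case by auto
next
  case (Suc t)
  then obtain h' s where h': "h' \<in> set_pmf (bb_path N nu0 nd0 (exp r2) (exp r1) p0 t)"
    and s: "s \<in> set_pmf (bb_step N (exp r2) (exp r1) (last h'))" and h: "h = h' @ [s]"
    by auto
  obtain nu nd where le: "nu \<le> nu0" "nd \<le> nd0"
    and eq: "h' ! t = (nu, nd, p0 * exp (r2 * (real nu0 - real nu) + r1 * (real nd0 - real nd)))"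
    using Suc.IH[OF h'] by auto
  have "h ! Suc t = s"
    using length_bb_path[OF h'] by (simp add: h nth_append)
  moreover have "s \<in> set_pmf (bb_step N (exp r2) (exp r1)
      (nu, nd, p0 * exp (r2 * (real nu0 - real nu) + r1 * (real nd0 - real nd))))"
    using s last_bb_path[OF h'] eq by simp
  then consider "s = (nu, nd, p0 * exp (r2 * (real nu0 - real nu) + r1 * (real nd0 - real nd)))"
    | "nu > 0" "s = (nu - 1, nd, exp r2 * (p0 * exp (r2 * (real nu0 - real nu) + r1 * (real nd0 - real nd))))"
    | "nd > 0" "s = (nu, nd - 1, exp r1 * (p0 * exp (r2 * (real nu0 - real nu) + r1 * (real nd0 - real nd))))"
    using set_bb_step[OF assms(1)] by blast
  then have "\<exists>nu nd. nu \<le> nu0 \<and> nd \<le> nd0 \<and>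
    s = (nu, nd, p0 * exp (r2 * (real nu0 - real nu) + r1 * (real nd0 - real nd)))"
  proof cases
    case 1
    then show ?thesis using le by blast
  next
    case 2
    then show ?thesis using le
      by (intro exI[of _ "nu - 1"] exI[of _ nd])
         (simp add: of_nat_diff algebra_simps flip: exp_add)
  next
    case 3
    then show ?thesis using le
      by (intro exI[of _ nu] exI[of _ "nd - 1"])
         (simp add: of_nat_diff algebra_simps flip: exp_add)
  qed
  ultimately show ?case by simp
qed

text \<open>Tower property: given the history, the next step depends only on the last state, which
  is \<open>h ! t\<close>.\<close>

lemma expectation_bb_path_Suc:
  fixes f :: "bb_state \<Rightarrow> real"
  assumes "N \<ge> 1"
  shows "measure_pmf.expectation (bb_path N nu0 nd0 u d p0 (Suc t)) (\<lambda>h. f (h ! Suc t)) =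
    measure_pmf.expectation (bb_path N nu0 nd0 u d p0 t)
      (\<lambda>h. measure_pmf.expectation (bb_step N u d (h ! t)) f)"
proof -
  let ?P = "bb_path N nu0 nd0 u d p0 t"
  have "measure_pmf.expectation (bb_path N nu0 nd0 u d p0 (Suc t)) (\<lambda>h. f (h ! Suc t)) =
    (\<Sum>h\<in>set_pmf ?P. pmf ?P h *\<^sub>R
      measure_pmf.expectation (map_pmf (\<lambda>s. h @ [s]) (bb_step N u d (last h))) (\<lambda>h. f (h ! Suc t)))"
    unfolding bb_path.simps
    by (rule pmf_expectation_bind)
       (auto simp: finite_set_bb_path[OF assms] finite_set_bb_step[OF assms])
  also have "\<dots> = (\<Sum>h\<in>set_pmf ?P. measure_pmf.expectation (bb_step N u d (h ! t)) f * pmf ?P h)"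
    by (intro sum.cong refl) (simp add: last_bb_path length_bb_path nth_append)
  also have "\<dots> = measure_pmf.expectation ?P (\<lambda>h. measure_pmf.expectation (bb_step N u d (h ! t)) f)"
    by (rule integral_measure_pmf_real[symmetric]) (auto simp: finite_set_bb_path[OF assms])
  finally show ?thesis .
qed

definition count_ffact :: "nat \<Rightarrow> nat \<Rightarrow> bb_state \<Rightarrow> real" where
  "count_ffact a b s = ffact (real (fst s)) a * ffact (real (fst (snd s))) b"

lemma expectation_bb_step_count_ffact:
  assumes "N \<ge> 1" "nu + nd \<le> N"
  shows "measure_pmf.expectation (bb_step N u d (nu, nd, p)) (count_ffact a b) =
    (1 - real (a + b) / real N) * count_ffact a b (nu, nd, p)"
proof -
  \<comment> \<open>The weight \<open>nu / N\<close> of a bull being chosen turns the shifted falling factorial back into a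
    multiple of the original one.\<close>
  have drop: "real n * ffact (real (n - 1)) c = (real n - real c) * ffact (real n) c" for n c
    by (cases n) (use ffact_eq_shift[of "real n" c] in auto)
  have "real nu * count_ffact a b (nu - 1, nd, u * p)
      = (real nu - real a) * count_ffact a b (nu, nd, p)"
    using drop[of nu a] by (simp add: count_ffact_def)
  moreover have "real nd * count_ffact a b (nu, nd - 1, d * p)
      = (real nd - real b) * count_ffact a b (nu, nd, p)"
    using drop[of nd b] by (simp add: count_ffact_def mult.left_commute)
  ultimately show ?thesis
    using assms by (simp add: expectation_bb_step field_simps)
qed

lemma expectation_bb_path_count_ffact:
  assumes "N \<ge> 1" "nu0 + nd0 \<le> N"
  shows "measure_pmf.expectation (bb_path N nu0 nd0 (exp r2) (exp r1) p0 t)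
      (\<lambda>h. count_ffact a b (h ! t)) =
    ffact (real nu0) a * ffact (real nd0) b * (1 - real (a + b) / real N) ^ t"
proof (induction t)
  case 0
  then show ?case by (simp add: count_ffact_def)
next
  case (Suc t)
  let ?P = "bb_path N nu0 nd0 (exp r2) (exp r1) p0 t"
  have "measure_pmf.expectation ?P
      (\<lambda>h. measure_pmf.expectation (bb_step N (exp r2) (exp r1) (h ! t)) (count_ffact a b))
    = measure_pmf.expectation ?P (\<lambda>h. (1 - real (a + b) / real N) * count_ffact a b (h ! t))"
  proof (rule integral_cong_AE)
    \<comment> \<open>The eigenvalue identity is available under \<open>nu + nd \<le> N\<close>, so
      it is applied on the support, where the invariant supplies this bound.\<close>
    have "measure_pmf.expectation (bb_step N (exp r2) (exp r1) (h ! t)) (count_ffact a b)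
        = (1 - real (a + b) / real N) * count_ffact a b (h ! t)" if h: "h \<in> set_pmf ?P" for h
    proof -
      obtain nu nd p where "nu \<le> nu0" "nd \<le> nd0" "h ! t = (nu, nd, p)"
        using bb_path_invariant[OF assms(1) h] by blast
      then show ?thesis
        using expectation_bb_step_count_ffact[of N nu nd] assms by simp
    qed
    then show "AE h in ?P. measure_pmf.expectation (bb_step N (exp r2) (exp r1) (h ! t)) (count_ffact a b)
        = (1 - real (a + b) / real N) * count_ffact a b (h ! t)"
      by (simp add: AE_measure_pmf_iff)
  qed auto
  then show ?case
    unfolding expectation_bb_path_Suc[OF assms(1)] by (simp add: Suc)
qed

section \<open>Moments of the logarithmic return\<close>

lemma power_add_eq_sum_pairs:
  fixes a b :: real
  shows "(a + b) ^ n =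
    (\<Sum>(i, j)\<in>{(i, j). i + j = n}. fact n / (fact i * fact j) * (a ^ i * b ^ j))"
proof -
  have "(a + b) ^ n = (\<Sum>k\<le>n. real (n choose k) * a ^ k * b ^ (n - k))"
    by (rule binomial_ring)
  also have "\<dots> = (\<Sum>(i, j)\<in>{(i, j). i + j = n}. fact n / (fact i * fact j) * (a ^ i * b ^ j))"
    by (rule sum.reindex_bij_witness[where i = fst and j = "\<lambda>k. (k, n - k)"])
       (auto simp: binomial_fact)
  finally show ?thesis .
qed

text \<open>The initial counts minus the remaining ones are the numbers of bulls and bears chosen up
  to time \<open>t\<close>.\<close>

definition joint_factorial_moment ::
  "nat \<Rightarrow> nat \<Rightarrow> nat \<Rightarrow> real \<Rightarrow> real \<Rightarrow> real \<Rightarrow> nat \<Rightarrow> nat \<Rightarrow> nat \<Rightarrow> real" where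
  "joint_factorial_moment N nu0 nd0 u d p0 t k l =
     measure_pmf.expectation (bb_path N nu0 nd0 u d p0 t)
       (\<lambda>h. ffact (real nu0 - real (fst (h ! t))) k * ffact (real nd0 - real (fst (snd (h ! t)))) l)"

text \<open>Applying \<open>ffact_diff\<close> in both coordinates leaves a combination of
  \<open>count_ffact i j\<close> with constant coefficients.\<close>

lemma joint_factorial_moment_eq:
  assumes "N \<ge> 1" "nu0 + nd0 \<le> N"
  shows "joint_factorial_moment N nu0 nd0 (exp r2) (exp r1) p0 t k l =
    (\<Sum>i\<le>k. \<Sum>j\<le>l. (real (k choose i) * (- 1) ^ i * ffact (real nu0 - real i) (k - i)) *
        (real (l choose j) * (- 1) ^ j * ffact (real nd0 - real j) (l - j)) *
        (ffact (real nu0) i * ffact (real nd0) j * (1 - real (i + j) / real N) ^ t))"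
proof -
  let ?P = "bb_path N nu0 nd0 (exp r2) (exp r1) p0 t"
  note [simp] = integrable_measure_pmf_finite[OF finite_set_bb_path[OF assms(1)]]
  have "joint_factorial_moment N nu0 nd0 (exp r2) (exp r1) p0 t k l =
    measure_pmf.expectation ?P (\<lambda>h. \<Sum>i\<le>k. \<Sum>j\<le>l.
      (real (k choose i) * (- 1) ^ i * ffact (real nu0 - real i) (k - i)) *
      (real (l choose j) * (- 1) ^ j * ffact (real nd0 - real j) (l - j)) *
        count_ffact i j (h ! t))"
    unfolding joint_factorial_moment_def count_ffact_def
      ffact_diff[of "real nu0" "real (fst _)"] ffact_diff[of "real nd0" "real (fst _)"] sum_product
    by (simp only: mult_ac)
  also have "\<dots> = (\<Sum>i\<le>k. \<Sum>j\<le>l.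
      (real (k choose i) * (- 1) ^ i * ffact (real nu0 - real i) (k - i)) *
      (real (l choose j) * (- 1) ^ j * ffact (real nd0 - real j) (l - j)) *
        measure_pmf.expectation ?P (\<lambda>h. count_ffact i j (h ! t)))"
    by (simp add: Bochner_Integration.integral_sum)
  finally show ?thesis
    by (simp add: expectation_bb_path_count_ffact[OF assms])
qed

text \<open>On the support the log return is \<open>r2 * X + r1 * Y\<close>; the binomial theorem
  and a Stirling expansion of both powers reduce its moments to joint factorial moments.\<close>

lemma log_return_moment_eq:
  assumes "N \<ge> 1" "p0 > 0"
  shows "log_return_moment N nu0 nd0 (exp r2) (exp r1) p0 t n =
    (\<Sum>(nu, nd)\<in>{(nu, nd). nu + nd = n}. fact n / (fact nu * fact nd) * r1 ^ nd * r2 ^ nu *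
      (\<Sum>ku\<le>nu. real (Stirling nu ku) * (\<Sum>kd\<le>nd. real (Stirling nd kd) *
        joint_factorial_moment N nu0 nd0 (exp r2) (exp r1) p0 t ku kd)))"
proof -
  let ?P = "bb_path N nu0 nd0 (exp r2) (exp r1) p0 t"
  define X where "X h = real nu0 - real (fst (h ! t))" for h :: "bb_state list"
  define Y where "Y h = real nd0 - real (fst (snd (h ! t)))" for h :: "bb_state list"
  note [simp] = integrable_measure_pmf_finite[OF finite_set_bb_path[OF assms(1)]]
  have XY: "measure_pmf.expectation ?P (\<lambda>h. X h ^ nu * Y h ^ nd) =
      (\<Sum>ku\<le>nu. real (Stirling nu ku) * (\<Sum>kd\<le>nd. real (Stirling nd kd) *
        joint_factorial_moment N nu0 nd0 (exp r2) (exp r1) p0 t ku kd))" for nu nd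
  proof -
    have "measure_pmf.expectation ?P (\<lambda>h. X h ^ nu * Y h ^ nd) =
      measure_pmf.expectation ?P (\<lambda>h. \<Sum>ku\<le>nu. real (Stirling nu ku) * (\<Sum>kd\<le>nd. real (Stirling nd kd) *
        (ffact (X h) ku * ffact (Y h) kd)))"
      unfolding power_eq_sum_Stirling_ffact sum_product by (simp add: sum_distrib_left mult_ac)
    then show ?thesis
      by (simp add: Bochner_Integration.integral_sum joint_factorial_moment_def X_def Y_def)
  qed
  have "log_return_moment N nu0 nd0 (exp r2) (exp r1) p0 t n =
    measure_pmf.expectation ?P (\<lambda>h. (r2 * X h + r1 * Y h) ^ n)"
    unfolding log_return_moment_def
  proof (rule integral_cong_AE)
    have "ln (price (h ! t) / p0) = r2 * X h + r1 * Y h" if "h \<in> set_pmf ?P" for h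
      using bb_path_invariant[OF assms(1) that] assms(2) by (auto simp: price_def X_def Y_def)
    then show "AE h in ?P. ln (price (h ! t) / p0) ^ n = (r2 * X h + r1 * Y h) ^ n"
      by (simp add: AE_measure_pmf_iff)
  qed auto
  also have "\<dots> = measure_pmf.expectation ?P (\<lambda>h. \<Sum>(nu, nd)\<in>{(nu, nd). nu + nd = n}.
      fact n / (fact nu * fact nd) * r1 ^ nd * r2 ^ nu * (X h ^ nu * Y h ^ nd))"
    unfolding power_add_eq_sum_pairs by (simp add: power_mult_distrib mult_ac)
  also have "\<dots> = (\<Sum>(nu, nd)\<in>{(nu, nd). nu + nd = n}.
      fact n / (fact nu * fact nd) * r1 ^ nd * r2 ^ nu *
        measure_pmf.expectation ?P (\<lambda>h. X h ^ nu * Y h ^ nd))"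
    by (simp add: Bochner_Integration.integral_sum case_prod_unfold)
  finally show ?thesis unfolding XY .
qed

section \<open>Limits in \<open>N\<close> and \<open>C\<close>\<close>

text \<open>Serves both for the time divided by \<open>N\<close> and for the initial counts divided
  by \<open>C\<close>.\<close>

lemma tendsto_real_nat_floor_mult_div:
  fixes L :: real
  assumes "L \<ge> 0"
  shows "((\<lambda>x. real (nat \<lfloor>L * x\<rfloor>) / x) \<longlongrightarrow> L) at_top"
proof (rule tendsto_sandwich)
  show "((\<lambda>x::real. L - 1 / x) \<longlongrightarrow> L) at_top"
    by real_asymp
  show "((\<lambda>x::real. L) \<longlongrightarrow> L) at_top" by simp
  have b: "L - 1 / x \<le> real (nat \<lfloor>L * x\<rfloor>) / x \<and> real (nat \<lfloor>L * x\<rfloor>) / x \<le> L" if "x > 0" for x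
  proof -
    have "L * x \<ge> 0" using assms that by simp
    then have "real (nat \<lfloor>L * x\<rfloor>) = of_int \<lfloor>L * x\<rfloor>" by simp
    then have "L * x - 1 \<le> real (nat \<lfloor>L * x\<rfloor>)" "real (nat \<lfloor>L * x\<rfloor>) \<le> L * x" by linarith+
    then have "(L * x - 1) / x \<le> real (nat \<lfloor>L * x\<rfloor>) / x" "real (nat \<lfloor>L * x\<rfloor>) / x \<le> L * x / x"
      using that by (intro divide_right_mono; simp)+
    then show ?thesis using that by (simp add: diff_divide_distrib)
  qed
  show "\<forall>\<^sub>F x in at_top. L - 1 / x \<le> real (nat \<lfloor>L * x\<rfloor>) / x"
    using eventually_gt_at_top[of 0] by eventually_elim (use b in auto)
  show "\<forall>\<^sub>F x in at_top. real (nat \<lfloor>L * x\<rfloor>) / x \<le> L"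
    using eventually_gt_at_top[of 0] by eventually_elim (use b in auto)
qed

lemma tendsto_one_minus_div_power_model_time:
  assumes "C > 1"
  shows "(\<lambda>N. (1 - real k / real N) ^ model_time C N) \<longlonglongrightarrow> (1 - 1 / C) ^ k"
proof -
  define L where "L = - ln (1 - 1 / C)"
  have q: "1 - 1 / C > 0" using assms by simp
  then have "L \<ge> 0" using assms by (simp add: L_def)
  from filterlim_compose[OF tendsto_real_nat_floor_mult_div[OF this] filterlim_real_sequentially]
  have t: "(\<lambda>N. real (model_time C N) / real N) \<longlonglongrightarrow> L"
    by (simp add: model_time_def L_def mult.commute)
  \<comment> \<open>Multiplied by the ratio of time to \<open>N\<close>, which tends to
    \<open>L\<close>, this gives the exponent \<open>- k * L = k * ln (1 - 1 / C)\<close>.\<close>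
  have "(\<lambda>N. real N * ln (1 - real k / real N)) \<longlonglongrightarrow> - real k"
    by real_asymp
  from tendsto_exp[OF tendsto_mult[OF t this]]
  have "(\<lambda>N. exp (real (model_time C N) / real N * (real N * ln (1 - real k / real N))))
      \<longlonglongrightarrow> exp (real k * ln (1 - 1 / C))"
    by (simp add: L_def mult.commute)
  also have "exp (real k * ln (1 - 1 / C)) = (1 - 1 / C) ^ k"
    using q by (simp add: exp_of_nat_mult)
  finally show ?thesis
  proof (rule Lim_transform_eventually)
    show "\<forall>\<^sub>F N in sequentially.
        exp (real (model_time C N) / real N * (real N * ln (1 - real k / real N))) =
        (1 - real k / real N) ^ model_time C N"
      using eventually_gt_at_top[of k]
    proof eventually_elim
      case (elim N)
      then have "1 - real k / real N > 0" by simp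
      then show ?case using elim by (simp add: exp_of_nat_mult)
    qed
  qed
qed

lemma powi_minus_add_eq:
  fixes C :: real
  shows "C powi (- int (k + l)) = inverse C ^ k * inverse C ^ l"
  unfolding power_int_minus power_int_of_nat by (simp add: power_add power_inverse)

lemma tendsto_joint_factorial_moment:
  assumes "C > 1"
  shows "(\<lambda>N. joint_factorial_moment N nu0 nd0 (exp r2) (exp r1) p0 (model_time C N) k l)
    \<longlonglongrightarrow> falling_fact nu0 k * falling_fact nd0 l * C powi (- int (k + l))"
proof -
  \<comment> \<open>The limiting probability that a given investor has not been chosen by the model
    time.\<close>
  define q where "q = 1 - 1 / C"
  let ?a = "\<lambda>i. real (k choose i) * (- 1) ^ i * ffact (real nu0 - real i) (k - i)"
  let ?b = "\<lambda>j. real (l choose j) * (- 1) ^ j * ffact (real nd0 - real j) (l - j)"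
  have "(\<lambda>N. \<Sum>i\<le>k. \<Sum>j\<le>l. ?a i * ?b j *
        (ffact (real nu0) i * ffact (real nd0) j * (1 - real (i + j) / real N) ^ model_time C N))
    \<longlonglongrightarrow> (\<Sum>i\<le>k. \<Sum>j\<le>l. ?a i * ?b j * (ffact (real nu0) i * ffact (real nd0) j * q ^ (i + j)))"
    unfolding q_def
    by (intro tendsto_sum tendsto_mult tendsto_const tendsto_one_minus_div_power_model_time assms)
  \<comment> \<open>Since \<open>q ^ (i + j)\<close> factors, so does the double sum: in the limit
    the joint factorial moments are those of independent counts.\<close>
  also have "(\<Sum>i\<le>k. \<Sum>j\<le>l. ?a i * ?b j * (ffact (real nu0) i * ffact (real nd0) j * q ^ (i + j)))
    = (\<Sum>i\<le>k. real (k choose i) * (- 1) ^ i * (ffact (real nu0) i * q ^ i) * ffact (real nu0 - real i) (k - i))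
    * (\<Sum>j\<le>l. real (l choose j) * (- 1) ^ j * (ffact (real nd0) j * q ^ j) * ffact (real nd0 - real j) (l - j))"
    unfolding sum_product by (simp add: power_add mult_ac)
  also have "\<dots> = falling_fact nu0 k * falling_fact nd0 l * C powi (- int (k + l))"
    unfolding sum_binomial_ffact powi_minus_add_eq
    by (simp add: falling_fact_eq q_def divide_inverse)
  finally show ?thesis
  proof (rule Lim_transform_eventually)
    show "\<forall>\<^sub>F N in sequentially. (\<Sum>i\<le>k. \<Sum>j\<le>l. ?a i * ?b j *
        (ffact (real nu0) i * ffact (real nd0) j * (1 - real (i + j) / real N) ^ model_time C N))
      = joint_factorial_moment N nu0 nd0 (exp r2) (exp r1) p0 (model_time C N) k l"
      using eventually_ge_at_top[of "max 1 (nu0 + nd0)"]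
      by eventually_elim (simp add: joint_factorial_moment_eq)
  qed
qed

lemma tendsto_log_return_moment:
  assumes "C > 1" "p0 > 0"
  shows "(\<lambda>N. log_return_moment N nu0 nd0 (exp r2) (exp r1) p0 (model_time C N) n)
    \<longlonglongrightarrow> approx_moment r1 r2 nu0 nd0 C n"
proof -
  have "(\<lambda>N. \<Sum>(nu, nd)\<in>{(nu, nd). nu + nd = n}. fact n / (fact nu * fact nd) * r1 ^ nd * r2 ^ nu *
      (\<Sum>ku\<le>nu. real (Stirling nu ku) * (\<Sum>kd\<le>nd. real (Stirling nd kd) *
        joint_factorial_moment N nu0 nd0 (exp r2) (exp r1) p0 (model_time C N) ku kd)))
    \<longlonglongrightarrow> (\<Sum>(nu, nd)\<in>{(nu, nd). nu + nd = n}. fact n / (fact nu * fact nd) * r1 ^ nd * r2 ^ nu *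
      (\<Sum>ku\<le>nu. real (Stirling nu ku) * (\<Sum>kd\<le>nd. real (Stirling nd kd) *
        (falling_fact nu0 ku * falling_fact nd0 kd * C powi (- int (ku + kd))))))"
    unfolding case_prod_unfold
    by (intro tendsto_sum tendsto_mult tendsto_const tendsto_joint_factorial_moment assms)
  also have "(\<Sum>(nu, nd)\<in>{(nu, nd). nu + nd = n}. fact n / (fact nu * fact nd) * r1 ^ nd * r2 ^ nu *
      (\<Sum>ku\<le>nu. real (Stirling nu ku) * (\<Sum>kd\<le>nd. real (Stirling nd kd) *
        (falling_fact nu0 ku * falling_fact nd0 kd * C powi (- int (ku + kd))))))
    = approx_moment r1 r2 nu0 nd0 C n"
    unfolding approx_moment_def by (simp add: sum_distrib_left mult_ac)
  finally show ?thesis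
  proof (rule Lim_transform_eventually)
    show "\<forall>\<^sub>F N in sequentially.
      (\<Sum>(nu, nd)\<in>{(nu, nd). nu + nd = n}. fact n / (fact nu * fact nd) * r1 ^ nd * r2 ^ nu *
        (\<Sum>ku\<le>nu. real (Stirling nu ku) * (\<Sum>kd\<le>nd. real (Stirling nd kd) *
          joint_factorial_moment N nu0 nd0 (exp r2) (exp r1) p0 (model_time C N) ku kd)))
      = log_return_moment N nu0 nd0 (exp r2) (exp r1) p0 (model_time C N) n"
      using eventually_ge_at_top[of 1]
      by eventually_elim (use assms in \<open>simp add: log_return_moment_eq\<close>)
  qed
qed

text \<open>Each of the \<open>k\<close> factors, divided by \<open>x\<close>, tends to
  \<open>L\<close>. The limit \<open>L ^ k\<close> is the factorial moment of a Poisson variable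
  with mean \<open>L\<close>.\<close>

lemma tendsto_falling_fact_nat_floor:
  assumes "L \<ge> 0"
  shows "((\<lambda>x. falling_fact (nat \<lfloor>L * x\<rfloor>) k * inverse x ^ k) \<longlongrightarrow> L ^ k) at_top"
proof (induction k)
  case 0
  then show ?case by (simp add: falling_fact_def)
next
  case (Suc k)
  have "((\<lambda>x. real k / x) \<longlongrightarrow> 0) at_top"
    by real_asymp
  from tendsto_mult[OF Suc tendsto_diff[OF tendsto_real_nat_floor_mult_div[OF assms] this]]
  have "((\<lambda>x. falling_fact (nat \<lfloor>L * x\<rfloor>) k * inverse x ^ k *
      (real (nat \<lfloor>L * x\<rfloor>) / x - real k / x)) \<longlongrightarrow> L ^ Suc k) at_top"
    by (simp add: mult.commute)
  then show ?case
    by (simp add: falling_fact_def divide_inverse algebra_simps)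
qed

lemma tendsto_approx_moment:
  assumes "l1 \<ge> 0" "l2 \<ge> 0"
  shows "((\<lambda>C. approx_moment r1 r2 (nat \<lfloor>l2 * C\<rfloor>) (nat \<lfloor>l1 * C\<rfloor>) C n) \<longlongrightarrow>
    (\<Sum>(nu, nd)\<in>{(nu, nd). nu + nd = n}. fact n / (fact nu * fact nd) * r1 ^ nd * r2 ^ nu *
      (\<Sum>ku\<le>nu. real (Stirling nu ku) * (\<Sum>kd\<le>nd. real (Stirling nd kd) *
        (l2 ^ ku * l1 ^ kd))))) at_top"
proof -
  have eq: "approx_moment r1 r2 nu0 nd0 C n =
    (\<Sum>(nu, nd)\<in>{(nu, nd). nu + nd = n}. fact n / (fact nu * fact nd) * r1 ^ nd * r2 ^ nu *
      (\<Sum>ku\<le>nu. real (Stirling nu ku) * (\<Sum>kd\<le>nd. real (Stirling nd kd) *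
        ((falling_fact nu0 ku * inverse C ^ ku) * (falling_fact nd0 kd * inverse C ^ kd)))))"
    for nu0 nd0 C
    unfolding approx_moment_def powi_minus_add_eq by (simp add: sum_distrib_left mult_ac)
  show ?thesis
    unfolding case_prod_unfold eq
    by (intro tendsto_sum tendsto_mult tendsto_const tendsto_falling_fact_nat_floor assms)
qed

section \<open>Cumulants\<close>

text \<open>The coefficients are \<open>m k / fact k\<close>, written out so that
  \<open>pderiv\<close> evaluates by simplification.\<close>

definition moment_poly_rep :: "(nat \<Rightarrow> real) \<Rightarrow> real poly" where
  "moment_poly_rep m = [:1, m 1, m 2 / 2, m 3 / 6, m 4 / 24:]"

lemma poly_moment_poly_rep: "poly (moment_poly_rep m) x = moment_poly m x"
  by (simp add: moment_poly_rep_def moment_poly_def eval_nat_numeral fact_numeral algebra_simps)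

text \<open>A closed form can be differentiated again only if it holds near \<open>x\<close>, so it
  is required on an open set.\<close>

lemma deriv_funpow_Suc_eq:
  assumes "open S" "x \<in> S"
    and "\<And>y. y \<in> S \<Longrightarrow> (deriv ^^ n) f y = g y"
    and "(g has_field_derivative D) (at x)"
  shows "(deriv ^^ Suc n) f x = D"
proof -
  have "\<forall>\<^sub>F y in nhds x. (deriv ^^ n) f y = g y"
    using assms eventually_nhds by blast
  then have "deriv ((deriv ^^ n) f) x = deriv g x"
    by (rule deriv_cong_ev) simp
  then show ?thesis
    using DERIV_imp_deriv[OF assms(4)] by simp
qed

lemma deriv_ln_poly:
  fixes p :: "real poly"
  assumes "poly p x > 0"
  defines "a \<equiv> \<lambda>k. poly ((pderiv ^^ k) p) x / poly p x"
  shows "(deriv ^^ 1) (\<lambda>x. ln (poly p x)) x = a 1"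
    and "(deriv ^^ 2) (\<lambda>x. ln (poly p x)) x = a 2 - (a 1)^2"
    and "(deriv ^^ 3) (\<lambda>x. ln (poly p x)) x = a 3 - 3 * a 1 * a 2 + 2 * (a 1)^3"
    and "(deriv ^^ 4) (\<lambda>x. ln (poly p x)) x =
      a 4 - 4 * a 1 * a 3 - 3 * (a 2)^2 + 12 * (a 1)^2 * a 2 - 6 * (a 1)^4"
proof -
  \<comment> \<open>\<open>b k = p\<^sup>(\<^sup>k\<^sup>) / p\<close> satisfies \<open>b k' = b (k + 1) - b k * b 1\<close>.\<close>
  define b where "b k x = poly ((pderiv ^^ k) p) x / poly p x" for k x
  define S where "S = {x. poly p x > 0}"
  have S: "open S"
    unfolding S_def by (intro open_Collect_less continuous_intros)
  have xS: "x \<in> S" using assms by (simp add: S_def)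
  have Db: "(b k has_field_derivative b (Suc k) y - b k y * b 1 y) (at y)" if "y \<in> S" for k y
    using that unfolding b_def[abs_def] S_def
    by (auto intro!: derivative_eq_intros simp: field_simps)
  note step = deriv_funpow_Suc_eq[OF S]
  have 1: "(deriv ^^ Suc 0) (\<lambda>x. ln (poly p x)) y = b 1 y" if "y \<in> S" for y
    by (rule step[OF that, of 0 _ "\<lambda>x. ln (poly p x)"])
       (use that in \<open>auto simp: b_def S_def intro!: derivative_eq_intros\<close>)
  have 2: "(deriv ^^ Suc (Suc 0)) (\<lambda>x. ln (poly p x)) y = b 2 y - (b 1 y)^2" if "y \<in> S" for y
    by (rule step[OF that 1])
       (use Db[OF that, of 1] in \<open>auto simp: power2_eq_square numeral_2_eq_2\<close>)
  have 3: "(deriv ^^ Suc (Suc (Suc 0))) (\<lambda>x. ln (poly p x)) y = b 3 y - 3 * b 1 y * b 2 y + 2 * (b 1 y)^3"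
    if "y \<in> S" for y
    by (rule step[OF that 2])
       (auto intro!: derivative_eq_intros Db that simp: eval_nat_numeral algebra_simps)
  have 4: "(deriv ^^ Suc (Suc (Suc (Suc 0)))) (\<lambda>x. ln (poly p x)) y =
      b 4 y - 4 * b 1 y * b 3 y - 3 * (b 2 y)^2 + 12 * (b 1 y)^2 * b 2 y - 6 * (b 1 y)^4"
    if "y \<in> S" for y
    by (rule step[OF that 3])
       (auto intro!: derivative_eq_intros Db that simp: eval_nat_numeral algebra_simps)
  show "(deriv ^^ 1) (\<lambda>x. ln (poly p x)) x = a 1"
    using 1[OF xS] by (simp add: a_def b_def)
  show "(deriv ^^ 2) (\<lambda>x. ln (poly p x)) x = a 2 - (a 1)^2"
    using 2[OF xS] by (simp add: a_def b_def numeral_2_eq_2)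
  show "(deriv ^^ 3) (\<lambda>x. ln (poly p x)) x = a 3 - 3 * a 1 * a 2 + 2 * (a 1)^3"
    using 3[OF xS] by (simp only: a_def b_def numeral_3_eq_3)
  show "(deriv ^^ 4) (\<lambda>x. ln (poly p x)) x =
      a 4 - 4 * a 1 * a 3 - 3 * (a 2)^2 + 12 * (a 1)^2 * a 2 - 6 * (a 1)^4"
    using 4[OF xS] by (simp only: a_def b_def eval_nat_numeral BitM.simps)
qed

text \<open>At \<open>0\<close> the moment polynomial is \<open>1\<close> and its first four
  derivatives are \<open>m 1\<close> to \<open>m 4\<close>, so the quotients in
  \<open>deriv_ln_poly\<close> are the moments themselves.\<close>

lemma cumulant_eq:
  "cumulant m 1 = m 1"
  "cumulant m 2 = m 2 - (m 1)^2"
  "cumulant m 3 = m 3 - 3 * m 1 * m 2 + 2 * (m 1)^3"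
  "cumulant m 4 = m 4 - 4 * m 1 * m 3 - 3 * (m 2)^2 + 12 * (m 1)^2 * m 2 - 6 * (m 1)^4"
proof -
  have pos: "poly (moment_poly_rep m) 0 > 0"
    by (simp add: moment_poly_rep_def)
  have d: "poly ((pderiv ^^ 1) (moment_poly_rep m)) 0 = m 1"
    "poly ((pderiv ^^ 2) (moment_poly_rep m)) 0 = m 2"
    "poly ((pderiv ^^ 3) (moment_poly_rep m)) 0 = m 3"
    "poly ((pderiv ^^ 4) (moment_poly_rep m)) 0 = m 4"
    "poly (moment_poly_rep m) 0 = 1"
    by (simp_all add: moment_poly_rep_def eval_nat_numeral pderiv_pCons)
  note D = deriv_ln_poly[OF pos, unfolded d poly_moment_poly_rep, folded cumulant_def]
  show "cumulant m 1 = m 1"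
  "cumulant m 2 = m 2 - (m 1)^2"
  "cumulant m 3 = m 3 - 3 * m 1 * m 2 + 2 * (m 1)^3"
  "cumulant m 4 = m 4 - 4 * m 1 * m 3 - 3 * (m 2)^2 + 12 * (m 1)^2 * m 2 - 6 * (m 1)^4"
    using D by (simp_all add: moment_poly_def)
qed

lemma moments_from_cumulants:
  "m 1 = cumulant m 1"
  "m 2 = cumulant m 2 + (cumulant m 1)^2"
  "m 3 = cumulant m 3 + 3 * cumulant m 1 * cumulant m 2 + (cumulant m 1)^3"
  "m 4 = cumulant m 4 + 4 * cumulant m 1 * cumulant m 3 + 3 * (cumulant m 2)^2
     + 6 * (cumulant m 1)^2 * cumulant m 2 + (cumulant m 1)^4"
  unfolding cumulant_eq by algebra+

section \<open>Prony's method for the pencil polynomial\<close>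

lemma pencil_poly_eq:
  "pencil_poly m =
    [:cumulant m 2 * cumulant m 4 - (cumulant m 3)^2,
      cumulant m 2 * cumulant m 3 - cumulant m 1 * cumulant m 4,
      cumulant m 1 * cumulant m 3 - (cumulant m 2)^2:]"
  by (simp add: pencil_poly_def det_2 hankel0_def hankel1_def power2_eq_square algebra_simps)

lemma matrix_inv_mult_vector:
  fixes A :: "real^'n^'n"
  assumes "det A \<noteq> 0"
  shows "A *v (matrix_inv A *v x) = x"
proof -
  have "\<exists>B. A ** B = mat 1 \<and> B ** A = mat 1"
    using assms invertible_det_nz[of A] by (simp add: invertible_def)
  then have "A ** matrix_inv A = mat 1"
    unfolding matrix_inv_def by (rule someI2_ex) simp
  then show ?thesis by (simp add: matrix_vector_mul_assoc)
qed

text \<open>Undoing both inverses leaves the matrix with rows \<open>(r1, r2)\<close> and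
  \<open>(r1^2, r2^2)\<close> applied to \<open>lam m r1 r2\<close>.\<close>

lemma lam_eqs:
  assumes "r1 \<noteq> 0" "r2 \<noteq> 0" "r1 \<noteq> r2"
  shows "lam m r1 r2 $ 1 * r1 + lam m r1 r2 $ 2 * r2 = cumulant m 1"
    and "lam m r1 r2 $ 1 * r1^2 + lam m r1 r2 $ 2 * r2^2 = cumulant m 2"
proof -
  have D: "det (dmat r1 r2) \<noteq> 0"
    using assms by (simp add: det_2 dmat_def)
  have V: "det (transpose (vmat r1 r2)) \<noteq> 0"
    unfolding det_transpose using assms by (simp add: det_2 vmat_def)
  have "transpose (vmat r1 r2) *v (dmat r1 r2 *v lam m r1 r2) = vector [cumulant m 1, cumulant m 2]"
    unfolding lam_def matrix_inv_mult_vector[OF D] matrix_inv_mult_vector[OF V] ..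
  then show "lam m r1 r2 $ 1 * r1 + lam m r1 r2 $ 2 * r2 = cumulant m 1"
    and "lam m r1 r2 $ 1 * r1^2 + lam m r1 r2 $ 2 * r2^2 = cumulant m 2"
    by (simp_all add: vec_eq_iff forall_2 matrix_vector_mult_def sum_2 transpose_def vmat_def
        dmat_def power2_eq_square algebra_simps)
qed

lemma cumulant_eq_power_sums:
  assumes "degree (pencil_poly m) = 2"
    and "poly (pencil_poly m) r1 = 0" "poly (pencil_poly m) r2 = 0"
    and "r1 \<noteq> 0" "r2 \<noteq> 0" "r1 \<noteq> r2"
    and "n \<in> {1..4}"
  shows "cumulant m n = lam m r1 r2 $ 1 * r1 ^ n + lam m r1 r2 $ 2 * r2 ^ n"
proof -
  define k1 k2 k3 k4 where k: "k1 = cumulant m 1" "k2 = cumulant m 2" "k3 = cumulant m 3" "k4 = cumulant m 4"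
  define l1 l2 where l: "l1 = lam m r1 r2 $ 1" "l2 = lam m r1 r2 $ 2"
  define A where "A = k1 * k3 - k2^2"
  define B where "B = k2 * k3 - k1 * k4"
  define D where "D = k2 * k4 - k3^2"
  have p: "pencil_poly m = [:D, B, A:]"
    by (simp add: pencil_poly_eq A_def B_def D_def k)
  \<comment> \<open>By Vieta's formulas the Hankel determinants \<open>A, B, D\<close> turn into the linear recurrence with
    characteristic roots \<open>r1, r2\<close> for the cumulants.\<close>
  have A: "A \<noteq> 0" using assms(1) unfolding p by (auto split: if_splits)
  have r1: "D + B * r1 + A * r1^2 = 0" and r2: "D + B * r2 + A * r2^2 = 0"
    using assms(2,3) unfolding p by (simp_all add: power2_eq_square algebra_simps)
  have "(r2 - r1) * (B + A * (r1 + r2)) = 0"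
    using r1 r2 by algebra
  then have B: "B = - A * (r1 + r2)" using assms(6) by simp
  then have D: "D = A * (r1 * r2)" using r1 by algebra
  \<comment> \<open>\<open>A, B, D\<close> are signed minors of the rows \<open>(k1, k2, k3)\<close>
    and \<open>(k2, k3, k4)\<close>. Repeating either row in a determinant gives
    \<open>A * k3 + B * k2 + D * k1 = 0\<close> and
    \<open>A * k4 + B * k3 + D * k2 = 0\<close>.\<close>
  have "A * (k3 - ((r1 + r2) * k2 - r1 * r2 * k1)) = 0"
    using B D unfolding A_def B_def D_def by algebra
  then have k3: "k3 = (r1 + r2) * k2 - r1 * r2 * k1" using A by simp
  have "A * (k4 - ((r1 + r2) * k3 - r1 * r2 * k2)) = 0"
    using B D unfolding A_def B_def D_def by algebra
  then have k4: "k4 = (r1 + r2) * k3 - r1 * r2 * k2" using A by simp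
  have 1: "k1 = l1 * r1 + l2 * r2" and 2: "k2 = l1 * r1^2 + l2 * r2^2"
    using lam_eqs[OF assms(4-6), of m] by (simp_all add: k l)
  \<comment> \<open>The power sums satisfy the same recurrence and agree with the cumulants in the
    first two terms.\<close>
  have 3: "k3 = l1 * r1^3 + l2 * r2^3"
    unfolding k3 1 2 by algebra
  have 4: "k4 = l1 * r1^4 + l2 * r2^4"
    unfolding k4 3 2 by algebra
  have "n = 1 \<or> n = 2 \<or> n = 3 \<or> n = 4" using assms(7) by auto
  then show ?thesis using 1 2 3 4 unfolding k l by auto
qed

section \<open>Moments of the Poisson limit\<close>

lemma pairs_sum_eq_image: "{(i::nat, j). i + j = n} = (\<lambda>i. (i, n - i)) ` {..n}"
  by (auto simp: image_iff)

text \<open>For nonnegative \<open>l1, l2\<close> the sum is the \<open>n\<close>-th moment of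
  \<open>r2 * X + r1 * Y\<close> with independent Poisson variables of means \<open>l2\<close> and
  \<open>l1\<close>, whose cumulants are the assumed ones. Up to order four, cumulants determine
  moments by explicit polynomials, which are compared case by case.\<close>

lemma moment_eq_Touchard_sum:
  fixes m :: "nat \<Rightarrow> real"
  assumes "\<And>k. k \<in> {1..4} \<Longrightarrow> cumulant m k = l1 * r1 ^ k + l2 * r2 ^ k" and "n \<in> {1..4}"
  shows "(\<Sum>(nu, nd)\<in>{(nu, nd). nu + nd = n}. fact n / (fact nu * fact nd) * r1 ^ nd * r2 ^ nu *
      (\<Sum>ku\<le>nu. real (Stirling nu ku) * (\<Sum>kd\<le>nd. real (Stirling nd kd) *
        (l2 ^ ku * l1 ^ kd)))) = m n"
proof -
  \<comment> \<open>The Touchard polynomial: the \<open>n\<close>-th moment of a Poisson variable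
    with mean \<open>x\<close>.\<close>
  define T where "T x n = (\<Sum>k\<le>n. real (Stirling n k) * x ^ k)" for x and n
  have T: "T x 0 = 1" "T x (Suc 0) = x" "T x 2 = x + x^2" "T x 3 = x + 3 * x^2 + x^3"
    "T x 4 = x + 7 * x^2 + 6 * x^3 + x^4" for x
    by (simp_all add: T_def eval_nat_numeral)
  have c: "cumulant m 1 = l1 * r1 + l2 * r2" "cumulant m 2 = l1 * r1^2 + l2 * r2^2"
    "cumulant m 3 = l1 * r1^3 + l2 * r2^3" "cumulant m 4 = l1 * r1^4 + l2 * r2^4"
    using assms(1)[of 1] assms(1)[of 2] assms(1)[of 3] assms(1)[of 4] by simp_all
  have "(\<Sum>(nu, nd)\<in>{(nu, nd). nu + nd = n}. fact n / (fact nu * fact nd) * r1 ^ nd * r2 ^ nu *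
      (\<Sum>ku\<le>nu. real (Stirling nu ku) * (\<Sum>kd\<le>nd. real (Stirling nd kd) *
        (l2 ^ ku * l1 ^ kd)))) =
    (\<Sum>(nu, nd)\<in>{(nu, nd). nu + nd = n}. fact n / (fact nu * fact nd) * r1 ^ nd * r2 ^ nu *
      (T l2 nu * T l1 nd))"
    unfolding T_def sum_product by (simp add: sum_distrib_left mult_ac)
  also have "\<dots> = (\<Sum>k\<le>n. fact n / (fact k * fact (n - k)) * r1 ^ (n - k) * r2 ^ k *
      (T l2 k * T l1 (n - k)))"
    unfolding pairs_sum_eq_image by (subst sum.reindex) (auto simp: inj_on_def)
  also have "\<dots> = m n"
  proof -
    have s: "sum f {..1} = f 0 + f 1" "sum f {..2} = f 0 + f 1 + f 2"
      "sum f {..3} = f 0 + f 1 + f 2 + f 3" "sum f {..4} = f 0 + f 1 + f 2 + f 3 + f 4"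
      for f :: "nat \<Rightarrow> real"
      by (simp_all add: eval_nat_numeral)
    have "n = 1 \<or> n = 2 \<or> n = 3 \<or> n = 4" using assms(2) by auto
    then show ?thesis
    proof (elim disjE)
      assume "n = 1"
      then show ?thesis
        unfolding \<open>n = 1\<close> s moments_from_cumulants[of m] c by (simp add: T)
    next
      assume "n = 2"
      then show ?thesis
        unfolding \<open>n = 2\<close> s moments_from_cumulants[of m] c
        by (simp add: T fact_numeral) algebra
    next
      assume "n = 3"
      then show ?thesis
        unfolding \<open>n = 3\<close> s moments_from_cumulants[of m] c
        by (simp add: T fact_numeral) algebra
    next
      assume "n = 4"
      then show ?thesis
        unfolding \<open>n = 4\<close> s moments_from_cumulants[of m] c
        by (simp add: T fact_numeral) algebra
    qed
  qed
  finally show ?thesis .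
qed

section \<open>Combination of the limits in \<open>C\<close> and \<open>N\<close>\<close>

theorem mainTheorem3:
  fixes m :: "nat \<Rightarrow> real" and r1 r2 p0 \<epsilon> :: real
  assumes "degree (pencil_poly m) = 2"
    and "poly (pencil_poly m) r1 = 0" and "poly (pencil_poly m) r2 = 0"
    and "r1 \<noteq> 0" and "r2 \<noteq> 0" and "r1 < r2"
    and "lam m r1 r2 $ 1 > 0" and "lam m r1 r2 $ 2 > 0"
    and "p0 > 0" and "\<epsilon> > 0"
  shows "(\<exists>C0>1. \<forall>C\<ge>C0. \<forall>n\<in>{1..4}. \<bar>mu m r1 r2 C n - m n\<bar> < \<epsilon>) \<and>
    (\<forall>C>1. (\<forall>n\<in>{1..4}. \<bar>mu m r1 r2 C n - m n\<bar> < \<epsilon>) \<longrightarrow>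
      (\<exists>N0. \<forall>N\<ge>N0. N \<ge> max 1 (num_bulls m r1 r2 C + num_bears m r1 r2 C) \<longrightarrow>
        (\<forall>n\<in>{1..4}. \<bar>model_moment m r1 r2 p0 C N n - m n\<bar> < \<epsilon>))) \<and>
    (\<exists>C0>1. \<forall>C\<ge>C0. \<exists>N0. \<forall>N\<ge>N0.
      N \<ge> max 1 (num_bulls m r1 r2 C + num_bears m r1 r2 C) \<longrightarrow>
      (\<forall>n\<in>{1..4}. \<bar>model_moment m r1 r2 p0 C N n - m n\<bar> < \<epsilon>))"
proof -
  have "\<forall>\<^sub>F C in at_top. \<forall>n\<in>{1..4}. \<bar>mu m r1 r2 C n - m n\<bar> < \<epsilon>"
  proof (rule eventually_ball_finite, simp, rule ballI)
    fix n :: nat assume n: "n \<in> {1..4}"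
    have "((\<lambda>C. mu m r1 r2 C n) \<longlongrightarrow> m n) at_top"
      using tendsto_approx_moment[of "lam m r1 r2 $ 1" "lam m r1 r2 $ 2" r1 r2 n]
        moment_eq_Touchard_sum[OF cumulant_eq_power_sums[OF assms(1-5)] n] assms(6-8)
      by (simp add: mu_def num_bulls_def num_bears_def)
    then show "\<forall>\<^sub>F C in at_top. \<bar>mu m r1 r2 C n - m n\<bar> < \<epsilon>"
      using assms(10) by (auto simp: tendsto_iff dist_real_def)
  qed
  then obtain C1 where C1: "\<And>C. C \<ge> C1 \<Longrightarrow> \<forall>n\<in>{1..4}. \<bar>mu m r1 r2 C n - m n\<bar> < \<epsilon>"
    by (auto simp: eventually_at_top_linorder)
  \<comment> \<open>The \<open>2\<close> secures \<open>C > 1\<close>.\<close>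
  have large_C: "\<forall>n\<in>{1..4}. \<bar>mu m r1 r2 C n - m n\<bar> < \<epsilon>" if "C \<ge> max 2 C1" for C
    using C1[of C] that by simp
  have large_N: "\<exists>N0. \<forall>N\<ge>N0. \<forall>n\<in>{1..4}. \<bar>model_moment m r1 r2 p0 C N n - m n\<bar> < \<epsilon>"
    if "C > 1" "\<forall>n\<in>{1..4}. \<bar>mu m r1 r2 C n - m n\<bar> < \<epsilon>" for C
  proof -
    have "\<forall>\<^sub>F N in sequentially. \<forall>n\<in>{1..4}. \<bar>model_moment m r1 r2 p0 C N n - m n\<bar> < \<epsilon>"
    proof (rule eventually_ball_finite, simp, rule ballI)
      fix n :: nat assume n: "n \<in> {1..4}"
      have "(\<lambda>N. model_moment m r1 r2 p0 C N n) \<longlonglongrightarrow> mu m r1 r2 C n"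
        unfolding model_moment_def mu_def
        by (rule tendsto_log_return_moment) (use that assms in auto)
      \<comment> \<open>For fixed \<open>C\<close> the limit \<open>mu m r1 r2 C n\<close> may
        differ from \<open>m n\<close>, but the strict bound on their distance passes to all large
        \<open>N\<close>.\<close>
      then have "(\<lambda>N. \<bar>model_moment m r1 r2 p0 C N n - m n\<bar>) \<longlonglongrightarrow> \<bar>mu m r1 r2 C n - m n\<bar>"
        by (intro tendsto_intros)
      then show "\<forall>\<^sub>F N in sequentially. \<bar>model_moment m r1 r2 p0 C N n - m n\<bar> < \<epsilon>"
        by (rule order_tendstoD(2)) (use that n in blast)
    qed
    then show ?thesis
      by (simp add: eventually_at_top_linorder)
  qed
  have "max 2 C1 > 1" by simp
  show ?thesis
  proof (intro conjI)
    show "\<exists>C0>1. \<forall>C\<ge>C0. \<forall>n\<in>{1..4}. \<bar>mu m r1 r2 C n - m n\<bar> < \<epsilon>"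
      using large_C \<open>max 2 C1 > 1\<close> by blast
    show "\<forall>C>1. (\<forall>n\<in>{1..4}. \<bar>mu m r1 r2 C n - m n\<bar> < \<epsilon>) \<longrightarrow>
      (\<exists>N0. \<forall>N\<ge>N0. N \<ge> max 1 (num_bulls m r1 r2 C + num_bears m r1 r2 C) \<longrightarrow>
        (\<forall>n\<in>{1..4}. \<bar>model_moment m r1 r2 p0 C N n - m n\<bar> < \<epsilon>))"
      using large_N by blast
    have "\<exists>N0. \<forall>N\<ge>N0. N \<ge> max 1 (num_bulls m r1 r2 C + num_bears m r1 r2 C) \<longrightarrow>
      (\<forall>n\<in>{1..4}. \<bar>model_moment m r1 r2 p0 C N n - m n\<bar> < \<epsilon>)" if "C \<ge> max 2 C1" for C
      using large_N[of C] large_C[OF that] that by auto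
    then show "\<exists>C0>1. \<forall>C\<ge>C0. \<exists>N0. \<forall>N\<ge>N0.
      N \<ge> max 1 (num_bulls m r1 r2 C + num_bears m r1 r2 C) \<longrightarrow>
      (\<forall>n\<in>{1..4}. \<bar>model_moment m r1 r2 p0 C N n - m n\<bar> < \<epsilon>)"
      using \<open>max 2 C1 > 1\<close> by blast
  qed
qed

end
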